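(* For every positive integer $n$, there exists an instance of fair division with $n$ agents having identical additive valuations and with conflict graph $G=(M,E)$, for which every complete EF1 allocation has at least $|E|/n$ violations.
   Context: $N=\{1,\dots,n\}$ is the set of agents and $M=\{1,\dots,m\}$ the set of indivisible goods. Each agent $i$ has an additive valuation $v_i:2^M\to\mathbb R_{\ge0}$, $v_i(S)=\sum_{g\in S}v_i(\{g\})$; valuations are identical if all $v_i$ are equal. An allocation is $\mathcal A=(A_1,\dots,A_n)$ with pairwise disjoint $A_i\subseteq M$; it is complete if $A_1\cup\dots\cup A_n=M$. It is EF1 (envy-free up to one good) if for all $i\ne j$ in $N$, either $A_j=\emptyset$ or there is $g\in A_j$ with $v_i(A_i)\ge v_i(A_j\setminus\{g\})$. The conflict graph $G=(M,E)$ is a simple undirected graph on the goods; an edge $\{u,w\}\in E$ is violated by $\mathcal A$ if $\{u,w\}\subseteq A_i$ for some $i$, and the number of violations is the number of violated edges. *)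

theory Defs
  imports Complex_Main "HOL-Library.Disjoint_Sets"
begin

definition agents :: "nat \<Rightarrow> nat set"
  where "agents n = {1..n}"

definition goods :: "nat \<Rightarrow> nat set"
  where "goods m = {1..m}"

definition additive_valuation :: "nat set \<Rightarrow> (nat set \<Rightarrow> real) \<Rightarrow> bool"
  where "additive_valuation M v \<longleftrightarrow>
    (\<forall>S\<subseteq>M. v S \<ge> 0 \<and> v S = (\<Sum>g\<in>S. v {g}))"

definition conflict_graph :: "nat set \<Rightarrow> nat set set \<Rightarrow> bool"
  where "conflict_graph M E \<longleftrightarrow> (\<forall>e\<in>E. e \<subseteq> M \<and> card e = 2)"

definition fair_division_instance ::
    "nat \<Rightarrow> nat \<Rightarrow> (nat \<Rightarrow> nat set \<Rightarrow> real) \<Rightarrow> nat set set \<Rightarrow> bool"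
  where "fair_division_instance n m v E \<longleftrightarrow>
    (\<forall>i\<in>agents n. additive_valuation (goods m) (v i)) \<and> conflict_graph (goods m) E"

definition identical_valuations :: "nat \<Rightarrow> nat \<Rightarrow> (nat \<Rightarrow> nat set \<Rightarrow> real) \<Rightarrow> bool"
  where "identical_valuations n m v \<longleftrightarrow>
    (\<forall>i\<in>agents n. \<forall>j\<in>agents n. \<forall>S\<subseteq>goods m. v i S = v j S)"

text \<open>Bundles are indexed by all naturals, but only the values on \<open>agents n\<close> are
  ever constrained or inspected.\<close>

definition allocation :: "nat \<Rightarrow> nat \<Rightarrow> (nat \<Rightarrow> nat set) \<Rightarrow> bool"
  where "allocation n m A \<longleftrightarrow>
    (\<forall>i\<in>agents n. A i \<subseteq> goods m) \<and> disjoint_family_on A (agents n)"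

definition complete_allocation :: "nat \<Rightarrow> nat \<Rightarrow> (nat \<Rightarrow> nat set) \<Rightarrow> bool"
  where "complete_allocation n m A \<longleftrightarrow>
    allocation n m A \<and> (\<Union>i\<in>agents n. A i) = goods m"

definition EF1 :: "nat \<Rightarrow> (nat \<Rightarrow> nat set \<Rightarrow> real) \<Rightarrow> (nat \<Rightarrow> nat set) \<Rightarrow> bool"
  where "EF1 n v A \<longleftrightarrow>
    (\<forall>i\<in>agents n. \<forall>j\<in>agents n. i \<noteq> j \<longrightarrow>
      A j = {} \<or> (\<exists>g\<in>A j. v i (A i) \<ge> v i (A j - {g})))"

definition violated_edges :: "nat \<Rightarrow> nat set set \<Rightarrow> (nat \<Rightarrow> nat set) \<Rightarrow> nat set set"
  where "violated_edges n E A = {e \<in> E. \<exists>i\<in>agents n. e \<subseteq> A i}"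

definition violations :: "nat \<Rightarrow> nat set set \<Rightarrow> (nat \<Rightarrow> nat set) \<Rightarrow> nat"
  where "violations n E A = card (violated_edges n E A)"

end

theory Submission
  imports Defs
begin

text \<open>Take \<open>n\<close> goods of value 1 and one worthless good, joined to all the others in a star with
  \<open>n\<close> edges. An agent without a valuable good would, by EF1, leave at most one to each of the
  other \<open>n - 1\<close> agents. So every agent holds a valuable good, and whoever receives the worthless
  good violates an edge.\<close>

lemma additive_valuation_card_Int:
  assumes "finite M"
  shows "additive_valuation M (\<lambda>S. real (card (S \<inter> B)))"
proof -
  have "real (card (S \<inter> B)) = (\<Sum>g\<in>S. real (card ({g} \<inter> B)))" if "S \<subseteq> M" for S
  proof -
    have "finite S"
      using that assms by (rule finite_subset)
    have "(\<Sum>g\<in>S. real (card ({g} \<inter> B))) = (\<Sum>g\<in>S. if g \<in> B then 1 else 0)"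
      by (rule sum.cong) auto
    also have "\<dots> = real (card (S \<inter> B))"
      using \<open>finite S\<close> by (simp add: sum.If_cases)
    finally show ?thesis ..
  qed
  then show ?thesis
    unfolding additive_valuation_def by (simp add: sum_nonneg)
qed

lemma EF1_bundle_meets_valued_goods:
  assumes compl: "complete_allocation n m A"
    and ef1: "EF1 n (\<lambda>_ S. real (card (S \<inter> B))) A"
    and B: "B \<subseteq> goods m" "n \<le> card B"
    and i: "i \<in> agents n"
  shows "A i \<inter> B \<noteq> {}"
proof
  assume empty: "A i \<inter> B = {}"
  have finB: "finite B"
    using B(1) by (rule finite_subset) (simp add: goods_def)
  have one: "card (A j \<inter> B) \<le> 1" if j: "j \<in> agents n - {i}" for j
  proof (cases "A j = {}")
    case False
    then obtain g where "real (card (A i \<inter> B)) \<ge> real (card ((A j - {g}) \<inter> B))"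
      using ef1[unfolded EF1_def, rule_format, of i j] i j by auto
    \<comment> \<open>The bundle of \<open>i\<close> has value 0, so EF1 forces what is left of
      \<open>A j\<close> to have value 0 too; as \<open>B\<close> is finite, a count of 0 means that
      no good of \<open>B\<close> is left.\<close>
    then have "(A j - {g}) \<inter> B = {}"
      using empty finB by simp
    then have "A j \<inter> B \<subseteq> {g}"
      by blast
    then show ?thesis
      using card_mono[of "{g}" "A j \<inter> B"] by simp
  qed simp
  have cover: "B \<subseteq> (\<Union>j\<in>agents n - {i}. A j \<inter> B)"
  proof
    fix g
    assume g: "g \<in> B"
    then have "g \<in> (\<Union>j\<in>agents n. A j)"
      using compl B(1) unfolding complete_allocation_def by auto
    then obtain j where "j \<in> agents n" "g \<in> A j"
      by blast
    moreover have "j \<noteq> i"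
      using \<open>g \<in> A j\<close> g empty by auto
    ultimately show "g \<in> (\<Union>j\<in>agents n - {i}. A j \<inter> B)"
      using g by auto
  qed
  \<comment> \<open>Pigeonhole by a union bound: at most one good of \<open>B\<close> for each of
    \<open>n - 1\<close> agents. For \<open>n = 1\<close> the union is empty and the bound is
    0.\<close>
  have "card B \<le> card (\<Union>j\<in>agents n - {i}. A j \<inter> B)"
    using finB by (intro card_mono[OF _ cover]) (simp add: agents_def)
  also have "\<dots> \<le> (\<Sum>j\<in>agents n - {i}. card (A j \<inter> B))"
    by (rule card_UN_le) (simp add: agents_def)
  also have "\<dots> \<le> card (agents n - {i})"
    using sum_mono[OF one, where K = "agents n - {i}"] by simp
  also have "\<dots> < n"
    using i by (simp add: agents_def)
  finally show False
    using B(2) by simp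
qed

theorem proposition2:
  fixes n :: nat
  assumes "n \<ge> 1"
  shows "\<exists>(m :: nat) (v :: nat \<Rightarrow> nat set \<Rightarrow> real) (E :: nat set set).
    fair_division_instance n m v E \<and> identical_valuations n m v \<and> E \<noteq> {} \<and>
    (\<forall>A. complete_allocation n m A \<and> EF1 n v A \<longrightarrow>
      real (violations n E A) \<ge> real (card E) / real n)"
proof -
  \<comment> \<open>The good \<open>Suc n\<close> is worthless. With only \<open>n - 1\<close>
    valuable goods, giving one each to \<open>n - 1\<close> agents would be EF1 and leave the last
    agent free to take \<open>Suc n\<close> without violating an edge of the star.\<close>
  define v :: "nat \<Rightarrow> nat set \<Rightarrow> real" where "v = (\<lambda>_ S. real (card (S \<inter> {1..n})))"
  define E where "E = (\<lambda>g. {g, Suc n}) ` {1..n}"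
  have "conflict_graph (goods (Suc n)) E"
    by (auto simp: conflict_graph_def goods_def E_def card_insert_if)
  then have inst: "fair_division_instance n (Suc n) v E"
    unfolding fair_division_instance_def v_def
    using additive_valuation_card_Int[of "goods (Suc n)"] by (simp add: goods_def)
  have ident: "identical_valuations n (Suc n) v"
    by (simp add: identical_valuations_def v_def)
  \<comment> \<open>This rules out the trivial instance without edges, where the bound would be
    0.\<close>
  have "E \<noteq> {}"
    using assms by (simp add: E_def)
  have "finite E"
    by (simp add: E_def)
  have "card E \<le> n"
    unfolding E_def using card_image_le[of "{1..n}"] by simp
  have viol: "real (violations n E A) \<ge> real (card E) / real n"
    if compl: "complete_allocation n (Suc n) A" and ef1: "EF1 n v A" for A
  proof -
    \<comment> \<open>Completeness enters here: every edge contains \<open>Suc n\<close>, so leaving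
      that good unassigned would avoid all violations.\<close>
    have "Suc n \<in> (\<Union>i\<in>agents n. A i)"
      using compl by (simp add: complete_allocation_def goods_def)
    then obtain i where i: "i \<in> agents n" "Suc n \<in> A i"
      by blast
    have "A i \<inter> {1..n} \<noteq> {}"
      using EF1_bundle_meets_valued_goods[OF compl ef1[unfolded v_def] _ _ i(1)]
      by (simp add: goods_def)
    then obtain g where "g \<in> A i" "g \<in> {1..n}"
      by blast
    then have "{g, Suc n} \<in> violated_edges n E A"
      using i by (auto simp: violated_edges_def E_def)
    moreover have "finite (violated_edges n E A)"
      using \<open>finite E\<close> by (simp add: violated_edges_def)
    ultimately have "1 \<le> violations n E A"
      unfolding violations_def by (metis One_nat_def Suc_leI card_gt_0_iff empty_iff)
    \<comment> \<open>One violated edge suffices, since the star has at most \<open>n\<close>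
      edges.\<close>
    moreover have "real (card E) / real n \<le> 1"
      using \<open>card E \<le> n\<close> assms by simp
    ultimately show ?thesis
      by linarith
  qed
  show ?thesis
    using inst ident \<open>E \<noteq> {}\<close> viol by blast
qed

end
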